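(* Let $a,b,c,\nu,s\in\mathbb{C}$ with $\Re(c)>\Re(b)>0$, $\Re(s-\nu)>0$ and $\Re(s+\nu)>-1$. Then, provided that each side exists, for $|\arg(1-z)|<\pi$ $$\int_0^\infty p^{s-1}F_{p,\nu}(a,b;c;z)\,dp =\frac{2^{s-1}}{\sqrt\pi}\,\Gamma\left(\frac{s-\nu}{2}\right)\Gamma\left(\frac{s+\nu+1}{2}\right)\frac{B(b+s,c+s-b)}{B(b,c-b)}\,F(a,b+s;c+2s;z),$$ and for all $z\in\mathbb{C}$ $$\int_0^\infty p^{s-1}\Phi_{p,\nu}(b;c;z)\,dp =\frac{2^{s-1}}{\sqrt\pi}\,\Gamma\left(\frac{s-\nu}{2}\right)\Gamma\left(\frac{s+\nu+1}{2}\right)\frac{B(b+s,c+s-b)}{B(b,c-b)}\,\Phi(b+s;c+2s;z).$$ Here existence of the right-hand sides includes convergence of the Euler integral for $B(b+s,c+s-b)$, i.e. $\Re(b+s)>0$ and $\Re(c-b+s)>0$.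
   Context: $K_\mu(z)$ denotes the modified Bessel function of the second kind of order $\mu$; $B(x,y)$ (two arguments) is the classical Beta function $\int_0^1t^{x-1}(1-t)^{y-1}dt$, $\Re(x),\Re(y)>0$; $(a)_n$ is the Pochhammer symbol $(a)_0=1$, $(a)_n=a(a+1)\cdots(a+n-1)$. $F(a,b;c;z)$ is the Gauss hypergeometric function ${}_2F_1(a,b;c;z)$ (principal branch on $|\arg(1-z)|<\pi$) and $\Phi(b;c;z)$ is Kummer's confluent hypergeometric function ${}_1F_1(b;c;z)$. For $p>0$ the extended Beta function is $$B_{\nu}(x,y;p):= \sqrt{\frac{2p}{\pi}}\int_{0}^{1} t^{x-\frac{3}{2}}(1-t)^{y-\frac{3}{2}}\, K_{\nu+\frac{1}{2}}\left(\frac{p}{t(1-t)}\right)dt .$$ For $\Re(c)>\Re(b)>0$ and $p>0$ define $$F_{p,\nu}(a,b;c;z):=\sum_{n=0}^\infty(a)_n\,\frac{B_{\nu}(b+n,c-b;p)}{B(b,c-b)}\,\frac{z^n}{n!}\quad(|z|<1),$$ extended to $|\arg(1-z)|<\pi$ (i.e. $z\in\mathbb{C}\setminus[1,\infty)$) by analytic continuation; equivalently, on that domain, $$F_{p,\nu}(a,b;c;z)=\sqrt{\frac{2p}{\pi}}\,\frac{1}{B(b,c-b)}\int_0^1 t^{b-\frac{3}{2}}(1-t)^{c-b-\frac{3}{2}}(1-zt)^{-a}\, K_{\nu+\frac{1}{2}}\left(\frac{p}{t(1-t)}\right)dt.$$ Also $$\Phi_{p,\nu}(b;c;z):=\sum_{n=0}^\infty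 \frac{B_{\nu}(b+n,c-b;p)}{B(b,c-b)}\,\frac{z^n}{n!}\quad(z\in\mathbb{C}).$$ The left-hand sides in the claim are the Mellin transforms in the variable $p$ with index $s$. *)

theory Defs
  imports "HOL-Complex_Analysis.Complex_Analysis"
begin

text \<open>
  The modified Bessel function of the second kind (Macdonald function) of complex order
  \<open>\<mu>\<close>, given by its classical integral, which converges absolutely and represents
  \<open>K\<^sub>\<mu>(z)\<close> for every \<open>\<mu>\<close> whenever \<open>Re z > 0\<close>. Below it is only evaluated at
  positive real \<open>z\<close>.
\<close>
definition bessel_K :: "complex \<Rightarrow> complex \<Rightarrow> complex" where
  "bessel_K \<mu> z =
     integral {0..} (\<lambda>u::real. exp (- z * of_real (cosh u)) * cosh (\<mu> * of_real u))"

definition ext_Beta :: "real \<Rightarrow> complex \<Rightarrow> complex \<Rightarrow> complex \<Rightarrow> complex" where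
  "ext_Beta p \<nu> x y = of_real (sqrt (2 * p / pi)) *
     integral {0<..<1} (\<lambda>t::real. of_real t powr (x - 3/2) * of_real (1 - t) powr (y - 3/2) *
       bessel_K (\<nu> + 1/2) (of_real (p / (t * (1 - t)))))"

text \<open>The domain \<open>\<bar>arg (1 - z)\<bar> < \<pi>\<close>, i.e. the plane cut along \<open>[1, \<infinity>)\<close>.\<close>
definition cut_plane :: "complex set" where
  "cut_plane = - (complex_of_real ` {1..})"

text \<open>
  Analytic continuation of a function on the open unit disc to the cut plane. If a continuation
  exists, its values on the cut plane do not depend on the choice, by
  \<open>cut_plane_continuation_eq\<close> below.
\<close>
definition cut_plane_continuation :: "(complex \<Rightarrow> complex) \<Rightarrow> complex \<Rightarrow> complex" where
  "cut_plane_continuation f =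
     (SOME g. g holomorphic_on cut_plane \<and> (\<forall>z\<in>ball 0 1. g z = f z))"

definition Gauss_F :: "complex \<Rightarrow> complex \<Rightarrow> complex \<Rightarrow> complex \<Rightarrow> complex" where
  "Gauss_F a b c = cut_plane_continuation (eval_fps (fps_hypergeo [a, b] [c] 1))"

definition Kummer_Phi :: "complex \<Rightarrow> complex \<Rightarrow> complex \<Rightarrow> complex" where
  "Kummer_Phi b c = eval_fps (fps_hypergeo [b] [c] 1)"

definition ext_Gauss_F ::
  "real \<Rightarrow> complex \<Rightarrow> complex \<Rightarrow> complex \<Rightarrow> complex \<Rightarrow> complex \<Rightarrow> complex" where
  "ext_Gauss_F p \<nu> a b c = cut_plane_continuation
     (\<lambda>z. \<Sum>n. pochhammer a n * (ext_Beta p \<nu> (b + of_nat n) (c - b) / Beta b (c - b)) *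
             (z ^ n / fact n))"

definition ext_Kummer_Phi ::
  "real \<Rightarrow> complex \<Rightarrow> complex \<Rightarrow> complex \<Rightarrow> complex \<Rightarrow> complex" where
  "ext_Kummer_Phi p \<nu> b c z =
     (\<Sum>n. ext_Beta p \<nu> (b + of_nat n) (c - b) / Beta b (c - b) * (z ^ n / fact n))"

lemma ball_subset_cut_plane: "ball 0 1 \<subseteq> cut_plane"
  by (auto simp: cut_plane_def)

lemma open_cut_plane: "open cut_plane"
  unfolding cut_plane_def
  by (intro open_Compl closed_injective_linear_image) (auto simp: linear_of_real inj_on_def)

lemma connected_cut_plane: "connected cut_plane"
proof (rule starlike_imp_connected)
  have "closed_segment 0 z \<subseteq> cut_plane" if "z \<in> cut_plane" for z
  proof
    fix w assume "w \<in> closed_segment 0 z"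
    then obtain u where u: "0 \<le> u" "u \<le> 1" "w = of_real u * z"
      by (auto simp: in_segment scaleR_conv_of_real)
    show "w \<in> cut_plane"
    proof (rule ccontr)
      assume "w \<notin> cut_plane"
      then obtain x where x: "x \<ge> 1" "of_real u * z = of_real x"
        using u by (auto simp: cut_plane_def)
      then have "u > 0" using u by (cases "u = 0") auto
      then have "z = of_real (x / u)" "x / u \<ge> 1"
        using x u by (auto simp: field_simps)
      with that show False unfolding cut_plane_def by blast
    qed
  qed
  moreover have "0 \<in> cut_plane" using ball_subset_cut_plane by auto
  ultimately show "starlike cut_plane" unfolding starlike_def by blast
qed

lemma cut_plane_continuation_eq:
  assumes "g holomorphic_on cut_plane" "\<And>z. z \<in> ball 0 1 \<Longrightarrow> g z = f z" "z \<in> cut_plane"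
  shows "cut_plane_continuation f z = g z"
proof -
  let ?h = "cut_plane_continuation f"
  have h: "?h holomorphic_on cut_plane \<and> (\<forall>z\<in>ball 0 1. ?h z = f z)"
    unfolding cut_plane_continuation_def by (rule someI[of _ g]) (use assms in auto)
  show ?thesis
    by (rule analytic_continuation_open[of "ball 0 1" cut_plane])
       (use h assms ball_subset_cut_plane open_cut_plane connected_cut_plane in auto)
qed

end

theory Submission
  imports Defs
begin

text \<open>
  For fixed \<open>z\<close> both extended functions are Euler integrals over \<open>(0, 1)\<close> with the weight
  \<open>K(p / (t (1 - t)))\<close>, \<open>K\<close> being the Bessel function of order \<open>\<nu> + 1/2\<close>, and the factor
  \<open>\<phi>(t z)\<close>, where \<open>\<phi>(w)\<close> is \<open>(1 - w) powr (-a)\<close> or \<open>exp w\<close>. On the cut plane this holds because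
  such an integral is holomorphic in \<open>z\<close> and has the right power series in the unit disc.
  Exchanging the integrals over \<open>p\<close> and \<open>t\<close>, scaling \<open>p\<close> turns the weight into
  \<open>(t (1 - t)) powr (s + 1/2)\<close> times the Mellin transform of \<open>K\<close> at \<open>s + 1/2\<close>, and what is left
  is the Euler integral of the classical function with parameters shifted by \<open>s\<close>. The Mellin
  transform of \<open>K\<close> itself comes from exchanging integrals in its integral representation, which
  leaves a Gamma function times a Beta integral in disguise.
\<close>

subsection \<open>Mellin integrals\<close>

text \<open>
  The value \<open>0\<close> at nonpositive arguments spares all indicator functions of \<open>(0, \<infinity>)\<close> and \<open>(0, 1)\<close>.
\<close>
definition pos_powr :: "real \<Rightarrow> complex \<Rightarrow> complex" where
  "pos_powr x z = (if x > 0 then of_real x powr z else 0)"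

lemma pos_powr_pos: "x > 0 \<Longrightarrow> pos_powr x z = of_real x powr z"
  by (simp add: pos_powr_def)

lemma pos_powr_nonpos: "x \<le> 0 \<Longrightarrow> pos_powr x z = 0"
  by (simp add: pos_powr_def)

text \<open>Over a positive base the logarithm is real, so no branch of the complex power has to be
  tracked: measurability and exponent laws reduce to \<open>exp\<close> and the real
  \<open>ln\<close>.\<close>

lemma pos_powr_eq_exp: "pos_powr x z = (if x > 0 then exp (z * of_real (ln x)) else 0)"
  by (simp add: pos_powr_def powr_def Ln_of_real)

lemma pos_powr_measurable [measurable]:
  assumes [measurable]: "f \<in> borel_measurable M"
  shows "(\<lambda>x. pos_powr (f x) z) \<in> borel_measurable M"
  unfolding pos_powr_eq_exp by measurable

lemma pos_powr_add: "pos_powr x (z + w) = pos_powr x z * pos_powr x w"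
  by (simp add: pos_powr_eq_exp exp_add ring_distribs)

lemma pos_powr_mult: "x > 0 \<Longrightarrow> y > 0 \<Longrightarrow> pos_powr (x * y) z = pos_powr x z * pos_powr y z"
  by (simp add: pos_powr_eq_exp ln_mult exp_add ring_distribs)

lemma pos_powr_0: "x > 0 \<Longrightarrow> pos_powr x 0 = 1"
  by (simp add: pos_powr_eq_exp)

lemma pos_powr_1: "x > 0 \<Longrightarrow> pos_powr x 1 = of_real x"
  by (simp add: pos_powr_def)

lemma pos_powr_minus: "pos_powr x (-z) = inverse (pos_powr x z)"
  by (simp add: pos_powr_eq_exp exp_minus)

lemma pos_powr_inverse: "pos_powr (inverse x) z = pos_powr x (-z)"
  by (simp add: pos_powr_eq_exp ln_inverse)

lemma pos_powr_of_nat: "x > 0 \<Longrightarrow> pos_powr x (of_nat n) = of_real x ^ n"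
  by (simp add: pos_powr_def powr_nat)

lemma pos_powr_eq_0_iff [simp]: "pos_powr x z = 0 \<longleftrightarrow> x \<le> 0"
  by (auto simp: pos_powr_eq_exp)

text \<open>Invariance of the measure dp/p under scaling produces the factor
  \<open>pos_powr q (-w)\<close>. The second claim supplies the absolute inner integrals for the
  Fubini argument of \<open>Mellin_integral_mixture\<close>.\<close>

lemma has_bochner_integral_scale:
  fixes k :: "real \<Rightarrow> complex"
  assumes "has_bochner_integral lborel (\<lambda>p. pos_powr p (w - 1) * k p) I" and "q > 0"
  shows "has_bochner_integral lborel (\<lambda>p. pos_powr p (w - 1) * k (q * p)) (pos_powr q (-w) * I)"
    and "(LINT p|lborel. norm (pos_powr p (w - 1) * k (q * p))) =
           norm (pos_powr q (-w)) * (LINT p|lborel. norm (pos_powr p (w - 1) * k p))"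
proof -
  let ?f = "\<lambda>p. pos_powr p (w - 1) * k p"
  \<comment> \<open>The integrand becomes a constant times \<open>?f\<close> at the scaled point;
    \<open>0 + q * p\<close> is the shape of the affine substitution rule of
    \<open>lborel\<close>.\<close>
  have *: "pos_powr p (w - 1) * k (q * p) = pos_powr q (1 - w) * ?f (0 + q * p)" for p
  proof (cases "p > 0")
    case True
    have "pos_powr q (1 - w) * pos_powr q (w - 1) = 1"
      using \<open>q > 0\<close> by (simp add: pos_powr_0 flip: pos_powr_add)
    thus ?thesis using True \<open>q > 0\<close> by (simp add: pos_powr_mult)
  next
    case False
    thus ?thesis using \<open>q > 0\<close> by (simp add: pos_powr_nonpos mult_nonneg_nonpos)
  qed
  have f: "integrable lborel ?f" "integral\<^sup>L lborel ?f = I"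
    using assms(1) by (auto simp: has_bochner_integral_iff)
  have pq: "pos_powr q (1 - w) = of_real q * pos_powr q (-w)"
    using \<open>q > 0\<close> pos_powr_add[of q 1 "-w"] by (simp add: pos_powr_1)
  have "integrable lborel (\<lambda>p. ?f (0 + q * p))"
    using f(1) \<open>q > 0\<close> by (intro lborel_integrable_real_affine) auto
  moreover have "I = of_real q * (LINT p|lborel. ?f (0 + q * p))"
    using lborel_integral_real_affine[of q ?f 0] \<open>q > 0\<close> f(2) by (simp add: scaleR_conv_of_real)
  ultimately show "has_bochner_integral lborel (\<lambda>p. pos_powr p (w - 1) * k (q * p)) (pos_powr q (-w) * I)"
    unfolding * has_bochner_integral_iff by (auto simp: pq)
  have "(LINT p|lborel. norm (?f p)) = q * (LINT p|lborel. norm (?f (0 + q * p)))"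
    using lborel_integral_real_affine[of q "\<lambda>p. norm (?f p)" 0] \<open>q > 0\<close> by simp
  thus "(LINT p|lborel. norm (pos_powr p (w - 1) * k (q * p))) =
           norm (pos_powr q (-w)) * (LINT p|lborel. norm (?f p))"
    unfolding * using \<open>q > 0\<close> by (simp add: norm_mult pq)
qed

text \<open>
  The one application of Fubini's theorem: it yields the Beta integral, the Mellin transform of the
  Bessel function and the theorem itself.
\<close>
lemma Mellin_integral_mixture:
  fixes k g :: "real \<Rightarrow> complex" and q :: "real \<Rightarrow> real"
  assumes [measurable]: "k \<in> borel_measurable borel" "g \<in> borel_measurable borel" "q \<in> borel_measurable borel"
  assumes k: "has_bochner_integral lborel (\<lambda>p. pos_powr p (w - 1) * k p) I"
    and g: "has_bochner_integral lborel (\<lambda>y. g y * pos_powr (q y) (-w)) J"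
    and q: "\<And>y. g y \<noteq> 0 \<Longrightarrow> q y > 0"
  shows "AE p in lborel. p > 0 \<longrightarrow> integrable lborel (\<lambda>y. g y * k (q y * p))"
    and "has_bochner_integral lborel
           (\<lambda>p. pos_powr p (w - 1) * (LINT y|lborel. g y * k (q y * p))) (I * J)"
proof -
  define f where "f y p = pos_powr p (w - 1) * (g y * k (q y * p))" for y p
  have inner: "has_bochner_integral lborel (f y) (g y * pos_powr (q y) (-w) * I)"
    and inner_norm: "(LINT p|lborel. norm (f y p)) =
      norm (g y * pos_powr (q y) (-w)) * (LINT p|lborel. norm (pos_powr p (w - 1) * k p))" for y
  proof -
    have "has_bochner_integral lborel (f y) (g y * pos_powr (q y) (-w) * I) \<and>
      (LINT p|lborel. norm (f y p)) =
      norm (g y * pos_powr (q y) (-w)) * (LINT p|lborel. norm (pos_powr p (w - 1) * k p))"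
    \<comment> \<open>Positivity of \<open>q y\<close> is known only where \<open>g y\<close> is
      nonzero; elsewhere \<open>f y\<close> vanishes identically.\<close>
    proof (cases "g y = 0")
      case True
      thus ?thesis by (simp add: f_def[abs_def] has_bochner_integral_zero)
    next
      case False
      have f_eq: "f y = (\<lambda>p. g y * (pos_powr p (w - 1) * k (q y * p)))"
        by (simp add: f_def fun_eq_iff mult_ac)
      show ?thesis
        using has_bochner_integral_mult_right[OF has_bochner_integral_scale(1)[OF k q[OF False]], of "g y"]
          has_bochner_integral_scale(2)[OF k q[OF False]] False
        unfolding f_eq by (simp add: norm_mult mult_ac)
    qed
    thus "has_bochner_integral lborel (f y) (g y * pos_powr (q y) (-w) * I)"
      "(LINT p|lborel. norm (f y p)) =
      norm (g y * pos_powr (q y) (-w)) * (LINT p|lborel. norm (pos_powr p (w - 1) * k p))"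
      by blast+
  qed
  have f_meas [measurable]: "case_prod f \<in> borel_measurable (lborel \<Otimes>\<^sub>M lborel)"
    unfolding f_def by measurable
  \<comment> \<open>By \<open>inner_norm\<close> the absolute inner integral is a constant times the
    norm of the integrand in assumption \<open>g\<close>, hence integrable in
    \<open>y\<close>.\<close>
  have f_int: "integrable (lborel \<Otimes>\<^sub>M lborel) (case_prod f)"
  proof (rule lborel_pair.Fubini_integrable)
    show "integrable lborel (\<lambda>y. LINT p|lborel. norm (case (y, p) of (y, p) \<Rightarrow> f y p))"
      using g by (simp add: inner_norm has_bochner_integral_iff del: norm_mult)
    show "AE y in lborel. integrable lborel (\<lambda>p. case (y, p) of (y, p) \<Rightarrow> f y p)"
      using inner by (auto simp: has_bochner_integral_iff)
  qed fact
  have "AE p in lborel. integrable lborel (\<lambda>y. f y p)"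
    using lborel_pair.AE_integrable_snd[OF f_int] .
  thus "AE p in lborel. p > 0 \<longrightarrow> integrable lborel (\<lambda>y. g y * k (q y * p))"
  proof eventually_elim
    case (elim p)
    show ?case
    proof
      \<comment> \<open>Only for positive \<open>p\<close> is \<open>pos_powr p (w - 1)\<close>
        nonzero, so that it can be divided out of \<open>f y p\<close>.\<close>
      assume "p > 0"
      thus "integrable lborel (\<lambda>y. g y * k (q y * p))"
        using integrable_mult_right[OF elim, of "inverse (pos_powr p (w - 1))"]
        by (simp add: f_def flip: mult.assoc)
    qed
  qed
  have "(LINT p|lborel. LINT y|lborel. f y p) = (LINT y|lborel. LINT p|lborel. f y p)"
    by (rule lborel_pair.Fubini_integral[OF f_int])
  also have "\<dots> = I * J"
    using inner g by (simp add: has_bochner_integral_iff)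
  finally show "has_bochner_integral lborel
           (\<lambda>p. pos_powr p (w - 1) * (LINT y|lborel. g y * k (q y * p))) (I * J)"
    using lborel_pair.integrable_snd[OF f_int]
    by (simp add: f_def has_bochner_integral_iff)
qed

section \<open>Change of variables and the Gamma integral\<close>

text \<open>The change of variables formula for absolutely integrable functions concerns completed
  Lebesgue measure. Borel measurability of the new integrand, assumption \<open>meas\<close>, brings
  its result back to \<open>lborel\<close>.\<close>

lemma has_bochner_integral_substitution:
  fixes f :: "real \<Rightarrow> complex" and g h :: "real \<Rightarrow> real"
  assumes f: "has_bochner_integral lborel (\<lambda>x. indicator (g ` S) x *\<^sub>R f x) I"
    and S: "S \<in> sets borel"
    and deriv: "\<And>x. x \<in> S \<Longrightarrow> (g has_field_derivative h x) (at x)"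
    and inj: "inj_on g S"
    and meas: "(\<lambda>x. indicator S x *\<^sub>R (\<bar>h x\<bar> *\<^sub>R f (g x))) \<in> borel_measurable borel"
  shows "has_bochner_integral lborel (\<lambda>x. indicator S x *\<^sub>R (\<bar>h x\<bar> *\<^sub>R f (g x))) I"
proof -
  have int: "integrable lborel (\<lambda>x. indicator (g ` S) x *\<^sub>R f x)"
    and I: "(LINT x|lborel. indicator (g ` S) x *\<^sub>R f x) = I"
    using f by (auto simp: has_bochner_integral_iff)
  have "set_integrable lborel (g ` S) f" using int by (simp add: set_integrable_def)
  from set_borel_integral_eq_integral[OF this] have "integral (g ` S) f = I"
    using I by (simp add: set_lebesgue_integral_def)
  moreover have "f absolutely_integrable_on g ` S"
    using int by (simp add: set_integrable_def integrable_completion)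
  ultimately have *: "(\<lambda>x. \<bar>h x\<bar> *\<^sub>R f (g x)) absolutely_integrable_on S"
      "integral S (\<lambda>x. \<bar>h x\<bar> *\<^sub>R f (g x)) = I"
    using has_absolute_integral_change_of_variables_real[of S g h f I] S inj
      DERIV_subset[OF deriv] by auto
  have int': "integrable lborel (\<lambda>x. indicator S x *\<^sub>R (\<bar>h x\<bar> *\<^sub>R f (g x)))"
    using *(1) meas by (simp add: set_integrable_def integrable_completion)
  moreover from int' have "set_integrable lborel S (\<lambda>x. \<bar>h x\<bar> *\<^sub>R f (g x))"
    by (simp add: set_integrable_def)
  from set_borel_integral_eq_integral[OF this] *(2)
  have "(LINT x|lborel. indicator S x *\<^sub>R (\<bar>h x\<bar> *\<^sub>R f (g x))) = I"
    by (simp add: set_lebesgue_integral_def)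
  ultimately show ?thesis by (simp add: has_bochner_integral_iff)
qed

text \<open>Euler's integral, read as the Mellin transform of exp(-p): the kernel from which both
  the Beta integral and the Bessel transform are built.\<close>

lemma has_bochner_integral_Gamma:
  assumes "Re z > 0"
  shows "has_bochner_integral lborel (\<lambda>p. pos_powr p (z - 1) * of_real (exp (-p))) (Gamma z)"
proof -
  let ?f = "\<lambda>t. complex_of_real t powr (z - 1) / of_real (exp t)"
  have eq: "pos_powr p (z - 1) * of_real (exp (-p)) = indicator {0<..} p *\<^sub>R ?f p" for p
    by (simp add: pos_powr_def exp_minus field_simps indicator_def)
  have meas: "(\<lambda>p. indicator {0<..} p *\<^sub>R ?f p) \<in> borel_measurable lborel"
    unfolding eq[symmetric] by measurable
  have int: "set_integrable lborel {0<..} ?f"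
    using absolutely_integrable_Gamma_integral'[OF assms] meas
    by (simp add: set_integrable_def integrable_completion)
  have "(LINT p:{0<..}|lborel. ?f p) = Gamma z"
    using set_borel_integral_eq_integral(2)[OF int] Gamma_integral_complex'[OF assms]
    by (simp add: integral_unique)
  with int show ?thesis
    unfolding eq by (simp add: has_bochner_integral_iff set_integrable_def set_lebesgue_integral_def)
qed

subsection \<open>Beta integral and Bessel function\<close>

lemma Re_pos_imp_not_nonpos_Int:
  fixes z :: complex
  assumes "Re z > 0"
  shows "z \<notin> \<int>\<^sub>\<le>\<^sub>0"
  using assms by (auto elim!: nonpos_Ints_cases)

text \<open>The double integral of v^(\<alpha>-1) y^(\<alpha>+\<beta>-1) exp(-y(1+v)) is computed in
  both orders. Integrating over v first gives \<open>Gamma \<alpha> * Gamma \<beta>\<close>;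
  integrating over y first gives \<open>Gamma (\<alpha> + \<beta>)\<close> times the integral
  sought.\<close>

lemma has_bochner_integral_Beta_Ioi:
  assumes "Re \<alpha> > 0" "Re \<beta> > 0"
  shows "has_bochner_integral lborel
           (\<lambda>v. pos_powr v (\<alpha> - 1) * pos_powr (1 + v) (- (\<alpha> + \<beta>))) (Beta \<alpha> \<beta>)"
proof -
  let ?k = "\<lambda>p. complex_of_real (exp (-p))"
  let ?g = "\<lambda>y. pos_powr y (\<alpha> + \<beta> - 1) * ?k y"
  have g: "has_bochner_integral lborel (\<lambda>y. ?g y * pos_powr y (-\<alpha>)) (Gamma \<beta>)"
  proof -
    have "?g y * pos_powr y (-\<alpha>) = pos_powr y (\<beta> - 1) * ?k y" for y
      using pos_powr_add[of y "\<alpha> + \<beta> - 1" "-\<alpha>"] by (simp add: mult_ac)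
    thus ?thesis using has_bochner_integral_Gamma[OF assms(2)] by (simp only:)
  qed
  have *: "has_bochner_integral lborel
      (\<lambda>v. pos_powr v (\<alpha> - 1) * (LINT y|lborel. ?g y * ?k (y * v))) (Gamma \<alpha> * Gamma \<beta>)"
    by (rule Mellin_integral_mixture(2)[OF _ _ _ has_bochner_integral_Gamma[OF assms(1)] g])
       (auto simp: not_le)
  have inner: "(LINT y|lborel. ?g y * ?k (y * v)) = pos_powr (1 + v) (- (\<alpha> + \<beta>)) * Gamma (\<alpha> + \<beta>)"
    if "v > 0" for v
  proof -
    have "has_bochner_integral lborel (\<lambda>p. pos_powr p (\<alpha> + \<beta> - 1) * ?k ((1 + v) * p))
            (pos_powr (1 + v) (- (\<alpha> + \<beta>)) * Gamma (\<alpha> + \<beta>))"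
      using assms that by (intro has_bochner_integral_scale(1) has_bochner_integral_Gamma) auto
    moreover have "pos_powr p (\<alpha> + \<beta> - 1) * ?k ((1 + v) * p) = ?g p * ?k (p * v)" for p
      by (simp add: algebra_simps flip: exp_add of_real_mult)
    ultimately show ?thesis by (simp add: has_bochner_integral_iff)
  qed
  have nz: "Gamma (\<alpha> + \<beta>) \<noteq> 0"
    using assms by (simp add: Gamma_eq_zero_iff Re_pos_imp_not_nonpos_Int)
  have "pos_powr v (\<alpha> - 1) * (LINT y|lborel. ?g y * ?k (y * v)) =
          pos_powr v (\<alpha> - 1) * pos_powr (1 + v) (- (\<alpha> + \<beta>)) * Gamma (\<alpha> + \<beta>)" for v
  proof (cases "v > 0")
    case True
    show ?thesis unfolding inner[OF True] by (simp only: mult.assoc)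
  qed (simp add: pos_powr_nonpos)
  with * have "has_bochner_integral lborel
      (\<lambda>v. pos_powr v (\<alpha> - 1) * pos_powr (1 + v) (- (\<alpha> + \<beta>)) * Gamma (\<alpha> + \<beta>)) (Gamma \<alpha> * Gamma \<beta>)"
    by simp
  from has_bochner_integral_divide_zero[OF this, of "Gamma (\<alpha> + \<beta>)"] nz
  show ?thesis by (simp add: Beta_def)
qed

text \<open>The substitution v = t/(1-t) carries (0,1) onto the half-line of
  \<open>has_bochner_integral_Beta_Ioi\<close>, with 1 + v = 1/(1-t).\<close>

lemma has_bochner_integral_Beta:
  assumes "Re \<alpha> > 0" "Re \<beta> > 0"
  shows "has_bochner_integral lborel
           (\<lambda>t. pos_powr t (\<alpha> - 1) * pos_powr (1 - t) (\<beta> - 1)) (Beta \<alpha> \<beta>)"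
proof -
  let ?f = "\<lambda>v. pos_powr v (\<alpha> - 1) * pos_powr (1 + v) (- (\<alpha> + \<beta>))"
  let ?g = "\<lambda>t::real. t / (1 - t)"
  have img: "?g ` {0<..<1} = {0<..}"
  proof (intro equalityI subsetI)
    fix v :: real assume "v \<in> {0<..}"
    thus "v \<in> ?g ` {0<..<1}"
      by (intro image_eqI[of _ _ "v / (1 + v)"]) (auto simp: field_simps)
  qed auto
  have "has_bochner_integral lborel
      (\<lambda>t. indicator {0<..<1} t *\<^sub>R (\<bar>1 / (1 - t)\<^sup>2\<bar> *\<^sub>R ?f (?g t))) (Beta \<alpha> \<beta>)"
  proof (rule has_bochner_integral_substitution)
    have "indicator {0<..} v *\<^sub>R ?f v = ?f v" for v
      by (auto simp: indicator_def pos_powr_nonpos)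
    thus "has_bochner_integral lborel (\<lambda>v. indicator (?g ` {0<..<1}) v *\<^sub>R ?f v) (Beta \<alpha> \<beta>)"
      unfolding img using has_bochner_integral_Beta_Ioi[OF assms] by simp
    show "(?g has_field_derivative 1 / (1 - t)\<^sup>2) (at t)" if "t \<in> {0<..<1}" for t
      using that by (auto intro!: derivative_eq_intros simp: power2_eq_square field_simps)
    show "inj_on ?g {0<..<1}"
      by (auto simp: inj_on_def field_simps)
  qed auto
  moreover have "indicator {0<..<1} t *\<^sub>R (\<bar>1 / (1 - t)\<^sup>2\<bar> *\<^sub>R ?f (?g t)) =
        pos_powr t (\<alpha> - 1) * pos_powr (1 - t) (\<beta> - 1)" for t
  proof (cases "t \<in> {0<..<1}")
    case True
    define r where "r = 1 - t"
    have r: "r > 0" using True by (simp add: r_def)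
    have "1 + t / r = inverse r" using r by (simp add: r_def field_simps)
    hence "?f (t / r) = pos_powr (t * inverse r) (\<alpha> - 1) * pos_powr (inverse r) (- (\<alpha> + \<beta>))"
      by (simp add: divide_inverse)
    also have "\<dots> = pos_powr t (\<alpha> - 1) * (pos_powr r (1 - \<alpha>) * pos_powr r (\<alpha> + \<beta>))"
      using True r by (simp add: pos_powr_mult pos_powr_inverse add.commute)
    \<comment> \<open>The exponent \<beta>+1 is split so that the square of \<open>r\<close> cancels
      the Jacobian.\<close>
    also have "pos_powr r (1 - \<alpha>) * pos_powr r (\<alpha> + \<beta>) = pos_powr r (\<beta> - 1) * pos_powr r (of_nat 2)"
      by (simp flip: pos_powr_add add: algebra_simps)
    finally show ?thesis
      using True r unfolding r_def[symmetric]
      by (simp add: pos_powr_of_nat scaleR_conv_of_real del: of_nat_numeral)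
  qed (auto simp: pos_powr_nonpos)
  ultimately show ?thesis by simp
qed

section \<open>The Bessel function and its Mellin transform\<close>

text \<open>A Beta integral in disguise: v = exp(2u) maps the line onto the half-line, and 1 +
  exp(2u) = 2 exp(u) cosh(u).\<close>

lemma has_bochner_integral_cosh_powr:
  assumes "\<bar>Re \<mu>\<bar> < Re w"
  shows "has_bochner_integral lborel
           (\<lambda>u. exp (\<mu> * of_real u) * pos_powr (cosh u) (-w))
           (2 powr (w - 1) * Beta ((w + \<mu>) / 2) ((w - \<mu>) / 2))"
proof -
  define \<alpha> \<beta> where "\<alpha> = (w + \<mu>) / 2" and "\<beta> = (w - \<mu>) / 2"
  have re: "Re \<alpha> > 0" "Re \<beta> > 0" and w: "\<alpha> + \<beta> = w"
    using assms by (auto simp: \<alpha>_def \<beta>_def field_simps)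
  let ?f = "\<lambda>v. pos_powr v (\<alpha> - 1) * pos_powr (1 + v) (- w)"
  let ?g = "\<lambda>u::real. exp (2 * u)"
  have img: "range ?g = {0<..}"
  proof (intro equalityI subsetI)
    fix v :: real assume "v \<in> {0<..}"
    thus "v \<in> range ?g" by (intro image_eqI[of _ _ "ln v / 2"]) auto
  qed auto
  have "has_bochner_integral lborel
      (\<lambda>u. indicator UNIV u *\<^sub>R (\<bar>2 * exp (2 * u)\<bar> *\<^sub>R ?f (?g u))) (Beta \<alpha> \<beta>)"
  proof (rule has_bochner_integral_substitution)
    have "indicator {0<..} v *\<^sub>R ?f v = ?f v" for v
      by (auto simp: indicator_def pos_powr_nonpos)
    thus "has_bochner_integral lborel (\<lambda>v. indicator (range ?g) v *\<^sub>R ?f v) (Beta \<alpha> \<beta>)"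
      unfolding img using has_bochner_integral_Beta_Ioi[OF re] w by simp
    show "(?g has_field_derivative 2 * exp (2 * u)) (at u)" for u
      by (auto intro!: derivative_eq_intros)
  qed (auto simp: inj_on_def)
  \<comment> \<open>Apart from the power of cosh, what remains is 2 exp(2u) exp(2u(\<alpha>-1)) (2
    exp(u))^(-w) = 2^(1-w) exp((2\<alpha>-w)u), and 2\<alpha>-w = \<mu>.\<close>
  moreover have "indicator UNIV u *\<^sub>R (\<bar>2 * exp (2 * u)\<bar> *\<^sub>R ?f (?g u)) =
      2 powr (1 - w) * (exp (\<mu> * of_real u) * pos_powr (cosh u) (-w))" for u
  proof -
    have c: "cosh u > 0" by (rule cosh_real_pos)
    have "1 + ?g u = (2 * exp u) * cosh u"
      by (simp add: cosh_def algebra_simps flip: exp_add)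
    hence "pos_powr (1 + ?g u) (-w) = pos_powr 2 (-w) * pos_powr (exp u) (-w) * pos_powr (cosh u) (-w)"
      using c by (simp add: pos_powr_mult)
    moreover have "pos_powr 2 (-w) * 2 = 2 powr (1 - w)"
      by (simp add: pos_powr_def powr_diff powr_minus field_simps)
    moreover have "of_real (exp (2 * u)) * pos_powr (?g u) (\<alpha> - 1) * pos_powr (exp u) (-w) = exp (\<mu> * of_real u)"
      by (simp add: pos_powr_eq_exp flip: exp_of_real exp_add) (simp add: \<alpha>_def algebra_simps add_divide_distrib)
    ultimately show ?thesis
      by (simp add: scaleR_conv_of_real) (smt (verit) mult.assoc mult.commute)
  qed
  ultimately have "has_bochner_integral lborel
      (\<lambda>u. 2 powr (1 - w) * (exp (\<mu> * of_real u) * pos_powr (cosh u) (-w))) (Beta \<alpha> \<beta>)"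
    by simp
  from has_bochner_integral_mult_right[OF this, of "2 powr (w - 1)"]
  show ?thesis
    by (simp add: \<alpha>_def \<beta>_def powr_diff flip: mult.assoc)
qed

lemma borel_measurable_cosh [measurable]: "cosh \<in> borel_measurable (borel :: real measure)"
  by (intro borel_measurable_continuous_onI continuous_intros)

text \<open>
  The defining integrand of the Bessel function is even, so the half-line may be replaced by the
  whole line and the hyperbolic cosine of \<open>\<mu> u\<close> by \<open>exp (\<mu> u)\<close>.
\<close>
definition bessel_K_Lebesgue :: "complex \<Rightarrow> real \<Rightarrow> complex" where
  "bessel_K_Lebesgue \<mu> x =
     (LINT u|lborel. exp (\<mu> * of_real u) * of_real (exp (- (cosh u * x)))) / 2"

lemma bessel_K_Lebesgue_measurable [measurable]: "bessel_K_Lebesgue \<mu> \<in> borel_measurable borel"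
  unfolding bessel_K_Lebesgue_def by measurable

text \<open>The Bessel function is a mixture of the exponentials exp(-p cosh u). Each contributes
  \<open>Gamma w\<close> times a power of cosh u, and this \<open>Gamma w\<close> cancels the
  denominator of the resulting Beta value.\<close>

lemma has_bochner_integral_Mellin_bessel_K:
  assumes "\<bar>Re \<mu>\<bar> < Re w"
  shows "has_bochner_integral lborel (\<lambda>p. pos_powr p (w - 1) * bessel_K_Lebesgue \<mu> p)
           (2 powr (w - 2) * Gamma ((w - \<mu>) / 2) * Gamma ((w + \<mu>) / 2))"
proof -
  have w: "Re w > 0" using assms by linarith
  have "has_bochner_integral lborel (\<lambda>p. pos_powr p (w - 1) *
      (LINT u|lborel. exp (\<mu> * of_real u) * complex_of_real (exp (- (cosh u * p)))))
      (Gamma w * (2 powr (w - 1) * Beta ((w + \<mu>) / 2) ((w - \<mu>) / 2)))"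
    by (rule Mellin_integral_mixture(2)[OF _ _ _ has_bochner_integral_Gamma[OF w]
          has_bochner_integral_cosh_powr[OF assms]]) (auto simp: cosh_real_pos)
  from has_bochner_integral_divide_zero[OF this, of 2]
  have "has_bochner_integral lborel (\<lambda>p. pos_powr p (w - 1) * bessel_K_Lebesgue \<mu> p)
      (Gamma w * (2 powr (w - 1) * Beta ((w + \<mu>) / 2) ((w - \<mu>) / 2)) / 2)"
    by (simp add: bessel_K_Lebesgue_def)
  moreover have "(w + \<mu>) / 2 + (w - \<mu>) / 2 = w" by (simp add: field_simps)
  moreover have "Gamma w \<noteq> 0"
    using w by (simp add: Gamma_eq_zero_iff Re_pos_imp_not_nonpos_Int)
  moreover have "2 powr (w - 1) = 2 * 2 powr (w - 2 :: complex)"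
    using powr_add[of "2::complex" 1 "w - 2"] by simp
  ultimately show ?thesis by (simp add: Beta_def mult.commute mult.left_commute)
qed

text \<open>The bound exp(-y) <= n!/y^n with y = x cosh u and n > |Re \<mu>| reduces this to
  \<open>has_bochner_integral_cosh_powr\<close>. It covers every positive \<open>x\<close>, where
  \<open>Mellin_integral_mixture\<close> would give almost every one.\<close>

lemma integrable_bessel_K_Lebesgue:
  assumes "x > 0"
  shows "integrable lborel (\<lambda>u. exp (\<mu> * of_real u) * complex_of_real (exp (- (cosh u * x))))"
proof -
  obtain n :: nat where n: "\<bar>Re \<mu>\<bar> < of_nat n"
    using reals_Archimedean2 by blast
  let ?h = "\<lambda>u. exp (\<mu> * of_real u) * pos_powr (cosh u) (- of_nat n)"
  have "integrable lborel (\<lambda>u. (fact n / x ^ n) *\<^sub>R ?h u)"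
    using has_bochner_integral_cosh_powr[of \<mu> "of_nat n"] n
    by (intro integrable_scaleR_right) (auto simp: has_bochner_integral_iff)
  thus ?thesis
  proof (rule Bochner_Integration.integrable_bound)
    show "AE u in lborel. norm (exp (\<mu> * of_real u) * complex_of_real (exp (- (cosh u * x)))) \<le>
            norm ((fact n / x ^ n) *\<^sub>R ?h u)"
    proof (rule AE_I2)
      fix u :: real
      define y where "y = cosh u * x"
      have y: "y > 0" using assms by (simp add: y_def cosh_real_pos)
      have "y ^ n / fact n \<le> exp y"
      proof -
        \<comment> \<open>A single term of the exponential series, whose terms are all nonnegative
          here.\<close>
        have "(\<Sum>k\<in>{n}. inverse (fact k) * y ^ k) \<le> (\<Sum>k. inverse (fact k) * y ^ k)"
          using y by (intro sum_le_suminf summable_exp) auto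
        thus ?thesis by (simp add: exp_def field_simps)
      qed
      hence "exp (- y) \<le> fact n / y ^ n"
        using y by (simp add: exp_minus field_simps)
      also have "\<dots> = fact n / x ^ n * inverse (cosh u ^ n)"
        by (simp add: y_def power_mult_distrib field_simps)
      finally have "exp (- y) \<le> fact n / x ^ n * inverse (cosh u ^ n)" .
      hence "norm (exp (\<mu> * of_real u)) * exp (- y) \<le>
          norm (exp (\<mu> * of_real u)) * (fact n / x ^ n * inverse (cosh u ^ n))"
        by (rule mult_left_mono) auto
      thus "norm (exp (\<mu> * of_real u) * complex_of_real (exp (- (cosh u * x)))) \<le>
            norm ((fact n / x ^ n) *\<^sub>R ?h u)"
        using assms cosh_real_pos[of u]
        by (simp add: norm_mult pos_powr_minus pos_powr_of_nat norm_inverse norm_power y_def mult_ac)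
    qed
  qed measurable
qed

text \<open>Here \<open>F\<close> is the mean of \<open>E \<mu>\<close> and
  \<open>E (-\<mu>)\<close>, which the reflection u -> -u exchanges, so \<open>F\<close> and
  \<open>E \<mu>\<close> have equal integrals over the line. As \<open>F\<close> is even, the
  half-line carries half of that value.\<close>

lemma bessel_K_eq_Lebesgue:
  assumes "x > 0"
  shows "bessel_K \<mu> (of_real x) = bessel_K_Lebesgue \<mu> x"
proof -
  define E where "E \<mu> u = exp (\<mu> * of_real u) * complex_of_real (exp (- (cosh u * x)))" for \<mu> and u :: real
  define F where "F u = exp (- of_real x * of_real (cosh u)) * cosh (\<mu> * complex_of_real u)" for u :: real
  have E_int: "integrable lborel (E \<mu>)" for \<mu>
    unfolding E_def using integrable_bessel_K_Lebesgue[OF assms] .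
  have F_E: "F u = (E \<mu> u + E (-\<mu>) u) / 2" for u
  proof -
    have "exp (- of_real x * of_real (cosh u)) = complex_of_real (exp (- (cosh u * x)))"
      by (simp add: mult.commute flip: exp_of_real)
    thus ?thesis by (simp add: E_def F_def cosh_def[of "\<mu> * _"] scaleR_conv_of_real field_simps)
  qed
  have E_refl: "E (-\<mu>) u = E \<mu> (0 + (-1) * u)" for u
    by (simp add: E_def)
  have F_int: "integrable lborel F"
    using E_int by (simp add: F_E[abs_def])
  have F_refl: "F (0 + (-1) * u) = F u" for u
    by (simp add: F_def)
  have "(LINT u|lborel. E (-\<mu>) u) = (LINT u|lborel. E \<mu> u)"
    using lborel_integral_real_affine[of "-1" "E \<mu>" 0] by (simp add: E_refl)
  hence "(LINT u|lborel. F u) = (LINT u|lborel. E \<mu> u)"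
    using E_int by (simp add: F_E)
  also have "\<dots> = 2 * bessel_K_Lebesgue \<mu> x"
    by (simp add: bessel_K_Lebesgue_def E_def)
  finally have 1: "(LINT u|lborel. F u) = 2 * bessel_K_Lebesgue \<mu> x" .
  have int: "set_integrable lborel A F" if "A \<in> sets borel" for A
    using F_int that by (auto simp: set_integrable_def intro!: integrable_mult_indicator)
  have "(LINT u:{..0}|lborel. F u) = (LINT u:{0..}|lborel. F u)"
  proof -
    have "(LINT u:{..0}|lborel. F u) = (LINT u|lborel. indicator {..0} (0 + (-1) * u) *\<^sub>R F (0 + (-1) * u))"
      unfolding set_lebesgue_integral_def by (subst lborel_integral_real_affine[of "-1" _ 0]) auto
    also have "\<dots> = (LINT u:{0..}|lborel. F u)"
      unfolding F_refl set_lebesgue_integral_def by (simp add: indicator_def)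
    finally show ?thesis .
  qed
  moreover have "(LINT u|lborel. F u) = (LINT u:{..0}|lborel. F u) + (LINT u:{0..}|lborel. F u)"
  proof -
    have "(LINT u:{..0}|lborel. F u) + (LINT u:{0..}|lborel. F u) =
          (LINT u|lborel. indicator {..0} u *\<^sub>R F u + indicator {0..} u *\<^sub>R F u)"
      using int[of "{..0}"] int[of "{0..}"]
      by (simp add: set_lebesgue_integral_def set_integrable_def)
    also have "\<dots> = (LINT u|lborel. F u)"
    proof (rule integral_cong_AE)
      \<comment> \<open>The two closed half-lines overlap in the null set {0}.\<close>
      show "AE u in lborel. indicator {..0} u *\<^sub>R F u + indicator {0..} u *\<^sub>R F u = F u"
        using AE_lborel_singleton[of 0] by eventually_elim (auto simp: indicator_def)
    qed (use F_int in auto)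
    finally show ?thesis ..
  qed
  ultimately have "(LINT u:{0..}|lborel. F u) = bessel_K_Lebesgue \<mu> x"
    using 1 by simp
  thus ?thesis
    using set_borel_integral_eq_integral(2)[OF int, of "{0..}"] by (simp add: bessel_K_def F_def[abs_def])
qed

subsection \<open>Integrals of dilations\<close>

text \<open>A continuous factor is bounded on the compact interval, which contains the support of
  \<open>h\<close>. Outside it \<open>\<psi>\<close> is arbitrary, so measurability comes from the
  cut-off factor in \<open>eq\<close>.\<close>

lemma integrable_mult_continuous_on:
  fixes h \<psi> :: "real \<Rightarrow> complex"
  assumes h: "integrable lborel h" and supp: "\<And>t. t \<notin> {0<..<1} \<Longrightarrow> h t = 0"
    and cont: "continuous_on {0..1} \<psi>"
  shows "integrable lborel (\<lambda>t. h t * \<psi> t)"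
proof -
  have eq: "h t * \<psi> t = h t * (indicator {0..1} t *\<^sub>R \<psi> t)" for t
    using supp[of t] by (auto simp: indicator_def)
  have [measurable]: "(\<lambda>t. indicator {0..1} t *\<^sub>R \<psi> t) \<in> borel_measurable borel"
    by (rule borel_measurable_continuous_on_indicator[OF _ cont]) auto
  have [measurable]: "h \<in> borel_measurable borel"
    using h by auto
  have "bounded (\<psi> ` {0..1})"
    by (intro compact_imp_bounded compact_continuous_image cont compact_Icc)
  then obtain B where B: "\<And>t. t \<in> {0..1} \<Longrightarrow> norm (\<psi> t) \<le> B"
    unfolding bounded_iff by blast
  have "integrable lborel (\<lambda>t. B *\<^sub>R h t)" using h by simp
  thus ?thesis
  proof (rule Bochner_Integration.integrable_bound)
    show "AE t in lborel. norm (h t * \<psi> t) \<le> norm (B *\<^sub>R h t)"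
    proof (rule AE_I2)
      fix t show "norm (h t * \<psi> t) \<le> norm (B *\<^sub>R h t)"
      proof (cases "t \<in> {0<..<1}")
        case True
        hence "norm (\<psi> t) \<le> \<bar>B\<bar>" using B[of t] by auto
        hence "norm (h t) * norm (\<psi> t) \<le> norm (h t) * \<bar>B\<bar>" by (rule mult_left_mono) auto
        thus ?thesis by (simp add: norm_mult mult.commute)
      qed (simp add: supp)
    qed
  qed (unfold eq, measurable)
qed

text \<open>Differentiation under the integral sign by dominated convergence. Near \<open>z0\<close>
  the difference quotients are bounded by a bound \<open>L\<close> for \<open>deriv \<phi>\<close>
  on the compact set \<open>K\<close> of all dilates of a closed ball; \<open>star\<close> keeps
  \<open>K\<close> inside \<open>D\<close>.\<close>

lemma holomorphic_on_integral_dilation: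
  fixes h :: "real \<Rightarrow> complex" and \<phi> :: "complex \<Rightarrow> complex"
  assumes h: "integrable lborel h" and supp: "\<And>t. t \<notin> {0<..<1} \<Longrightarrow> h t = 0"
    and "open D" and star: "\<And>z t. z \<in> D \<Longrightarrow> 0 \<le> t \<Longrightarrow> t \<le> 1 \<Longrightarrow> of_real t * z \<in> D"
    and hol: "\<phi> holomorphic_on D"
  shows "(\<lambda>z. LINT t|lborel. h t * \<phi> (of_real t * z)) holomorphic_on D"
  unfolding holomorphic_on_open[OF \<open>open D\<close>]
proof
  fix z0 assume z0: "z0 \<in> D"
  let ?G = "\<lambda>z. LINT t|lborel. h t * \<phi> (of_real t * z)"
  let ?d = "\<lambda>t. of_real t * deriv \<phi> (of_real t * z0)"
  have deriv: "(\<phi> has_field_derivative deriv \<phi> z) (at z)" if "z \<in> D" for z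
    using hol \<open>open D\<close> that holomorphic_derivI by blast
  have deriv': "((\<lambda>z. \<phi> (of_real t * z)) has_field_derivative of_real t * deriv \<phi> (of_real t * z)) (at z)"
    if "z \<in> D" "0 \<le> t" "t \<le> 1" for z and t :: real
  proof -
    have "((\<lambda>z. of_real t * z) has_field_derivative of_real t) (at z)"
      by (auto intro!: derivative_eq_intros)
    from DERIV_chain2[where f = \<phi>, OF deriv[OF star[OF that]] this] show ?thesis
      by (simp add: mult.commute)
  qed
  have cont: "continuous_on {0..1} (\<lambda>t. f (complex_of_real t * z))"
    if "z \<in> D" "continuous_on D f" for z and f :: "complex \<Rightarrow> complex"
    by (rule continuous_on_compose2[OF that(2)]) (auto intro!: continuous_intros star that)
  have cont_\<phi>: "continuous_on D \<phi>" and cont_d: "continuous_on D (deriv \<phi>)"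
    using hol \<open>open D\<close> by (auto intro!: holomorphic_on_imp_continuous_on holomorphic_deriv)
  have int: "integrable lborel (\<lambda>t. h t * \<phi> (of_real t * z))" if "z \<in> D" for z
    by (rule integrable_mult_continuous_on[OF h supp cont[OF that cont_\<phi>]])
  obtain r where r: "r > 0" "cball z0 r \<subseteq> D"
    using \<open>open D\<close> z0 open_contains_cball by blast
  define K where "K = (\<lambda>(t, z). complex_of_real t * z) ` ({0..1} \<times> cball z0 r)"
  have "compact K" unfolding K_def case_prod_beta
    by (intro compact_continuous_image compact_Times continuous_intros compact_Icc compact_cball)
  moreover have "K \<subseteq> D" using star r by (auto simp: K_def)
  ultimately have "bounded (deriv \<phi> ` K)"
    by (intro compact_imp_bounded compact_continuous_image continuous_on_subset[OF cont_d])
  then obtain L where L: "\<And>z. z \<in> K \<Longrightarrow> norm (deriv \<phi> z) \<le> L"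
    by (auto simp: bounded_iff)
  \<comment> \<open>The mean value inequality on the convex ball; the chain rule factor
    \<open>t\<close> is at most 1.\<close>
  have lip: "norm (\<phi> (of_real t * z) - \<phi> (of_real t * z0)) \<le> L * norm (z - z0)"
    if "z \<in> cball z0 r" "0 \<le> t" "t \<le> 1" for z and t :: real
  proof (rule field_differentiable_bound[where S = "cball z0 r"])
    fix y assume y: "y \<in> cball z0 r"
    show "((\<lambda>z. \<phi> (of_real t * z)) has_field_derivative of_real t * deriv \<phi> (of_real t * y))
            (at y within cball z0 r)"
      by (rule has_field_derivative_at_within, rule deriv') (use y r that in auto)
    have "of_real t * y \<in> K" using y that by (auto simp: K_def)
    hence "norm (deriv \<phi> (of_real t * y)) \<le> L" by (rule L)
    hence "\<bar>t\<bar> * norm (deriv \<phi> (of_real t * y)) \<le> 1 * L"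
      using that by (intro mult_mono) auto
    thus "norm (of_real t * deriv \<phi> (of_real t * y)) \<le> L" by (simp add: norm_mult)
  qed (use that r in auto)
  have "((\<lambda>y. (?G y - ?G z0) / (y - z0)) \<longlongrightarrow> (LINT t|lborel. h t * ?d t)) (at z0)"
    unfolding tendsto_at_iff_sequentially o_def
  proof (intro allI impI)
    fix X :: "nat \<Rightarrow> complex"
    assume X: "\<forall>i. X i \<in> UNIV - {z0}" "X \<longlonglongrightarrow> z0"
    from X(2) r(1) have "eventually (\<lambda>i. dist (X i) z0 < r) sequentially"
      by (rule tendstoD)
    then obtain N where N: "\<And>i. i \<ge> N \<Longrightarrow> X i \<in> cball z0 r"
      by (auto simp: eventually_sequentially dist_commute intro: less_imp_le)
    \<comment> \<open>From index \<open>N\<close> on the sequence lies in the ball where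
      \<open>lip\<close> applies; \<open>LIMSEQ_offset\<close> removes the shift at the end.\<close>
    have XN: "X (i + N) \<in> cball z0 r" "X (i + N) \<in> D" "X (i + N) \<noteq> z0" for i
      using N[of "i + N"] r X by auto
    define Q where "Q i t = (\<phi> (of_real t * X (i + N)) - \<phi> (of_real t * z0)) / (X (i + N) - z0)"
      for i and t :: real
    have hQ: "h t * Q i t =
        (h t * \<phi> (of_real t * X (i + N)) - h t * \<phi> (of_real t * z0)) / (X (i + N) - z0)" for i t
      by (simp add: Q_def right_diff_distrib)
    have hQ_int: "integrable lborel (\<lambda>t. h t * Q i t)" for i
      unfolding hQ using int[OF z0] int[OF XN(2)[of i]] by simp
    have hd_int: "integrable lborel (\<lambda>t. h t * ?d t)"
      by (intro integrable_mult_continuous_on[OF h supp] continuous_intros cont[OF z0 cont_d])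
    have "(\<lambda>i. LINT t|lborel. h t * Q i t) \<longlonglongrightarrow> (LINT t|lborel. h t * ?d t)"
    proof (rule integral_dominated_convergence[where w = "\<lambda>t. L * norm (h t)"])
      show "AE t in lborel. (\<lambda>i. h t * Q i t) \<longlonglongrightarrow> h t * ?d t"
      proof (rule AE_I2)
        fix t
        show "(\<lambda>i. h t * Q i t) \<longlonglongrightarrow> h t * ?d t"
        proof (cases "t \<in> {0<..<1}")
          case True
          hence "((\<lambda>y. (\<phi> (of_real t * y) - \<phi> (of_real t * z0)) / (y - z0)) \<longlongrightarrow> ?d t) (at z0)"
            using deriv'[OF z0, of t] by (simp add: has_field_derivative_iff)
          hence "(\<lambda>i. Q i t) \<longlonglongrightarrow> ?d t"
            unfolding tendsto_at_iff_sequentially o_def Q_def using X XN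
            by (auto intro: LIMSEQ_ignore_initial_segment)
          thus ?thesis by (intro tendsto_mult tendsto_const)
        qed (simp add: supp)
      qed
      show "AE t in lborel. norm (h t * Q i t) \<le> L * norm (h t)" for i
      proof (rule AE_I2)
        fix t show "norm (h t * Q i t) \<le> L * norm (h t)"
        proof (cases "t \<in> {0<..<1}")
          case True
          hence "norm (Q i t) \<le> L"
            using lip[OF XN(1)[of i], of t] XN(3)[of i] by (simp add: Q_def norm_divide field_simps)
          from mult_left_mono[OF this, of "norm (h t)"] show ?thesis
            by (simp add: norm_mult mult.commute)
        qed (simp add: supp)
      qed
    qed (use hQ_int hd_int h in auto)
    moreover have "(LINT t|lborel. h t * Q i t) = (?G (X (i + N)) - ?G z0) / (X (i + N) - z0)" for i
      unfolding hQ using int[OF z0] int[OF XN(2)[of i]] by simp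
    ultimately have "(\<lambda>i. (?G (X (i + N)) - ?G z0) / (X (i + N) - z0)) \<longlonglongrightarrow> (LINT t|lborel. h t * ?d t)"
      by simp
    thus "(\<lambda>i. (?G (X i) - ?G z0) / (X i - z0)) \<longlonglongrightarrow> (LINT t|lborel. h t * ?d t)"
      by (rule LIMSEQ_offset)
  qed
  thus "\<exists>f'. (?G has_field_derivative f') (at z0)"
    by (auto simp: has_field_derivative_iff)
qed

text \<open>Since 0 < t < 1 on the support of \<open>h\<close>, the n-th term is dominated by
  \<open>norm (c n * z ^ n) * norm (h t)\<close>. Absolute convergence at \<open>z\<close> alone
  therefore allows termwise integration.\<close>

lemma sums_integral_power_series:
  fixes h :: "real \<Rightarrow> complex" and \<phi> :: "complex \<Rightarrow> complex" and c :: "nat \<Rightarrow> complex"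
  assumes h: "integrable lborel h" and supp: "\<And>t. t \<notin> {0<..<1} \<Longrightarrow> h t = 0"
    and summable: "summable (\<lambda>n. norm (c n * z ^ n))"
    and sums: "\<And>t. t \<in> {0<..<1} \<Longrightarrow> (\<lambda>n. c n * (of_real t * z) ^ n) sums \<phi> (of_real t * z)"
  shows "(\<lambda>n. c n * z ^ n * (LINT t|lborel. h t * of_real t ^ n)) sums
           (LINT t|lborel. h t * \<phi> (of_real t * z))"
proof -
  define f where "f n t = c n * z ^ n * (h t * of_real t ^ n)" for n and t :: real
  have ht: "integrable lborel (\<lambda>t. h t * of_real t ^ n)" for n
    by (intro integrable_mult_continuous_on[OF h supp] continuous_intros)
  have f_int: "integrable lborel (f n)" for n
    unfolding f_def using ht by simp
  have norm_f: "norm (f n t) \<le> norm (c n * z ^ n) * norm (h t)" for n t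
  proof (cases "t \<in> {0<..<1}")
    case True
    hence "norm (h t) * \<bar>t\<bar> ^ n \<le> norm (h t) * 1"
      by (intro mult_left_mono power_le_one) auto
    thus ?thesis by (auto simp: f_def norm_mult norm_power intro!: mult_left_mono)
  qed (simp add: f_def supp)
  have "(\<lambda>n. LINT t|lborel. f n t) sums (LINT t|lborel. (\<Sum>n. f n t))"
  proof (rule sums_integral[OF f_int])
    show "AE t in lborel. summable (\<lambda>n. norm (f n t))"
      by (rule AE_I2, rule summable_comparison_test'[OF summable_mult2[OF summable]])
         (use norm_f in auto)
    show "summable (\<lambda>n. LINT t|lborel. norm (f n t))"
    proof (rule summable_comparison_test'[OF summable_mult2[OF summable]])
      fix n
      have "(LINT t|lborel. norm (f n t)) \<le> (LINT t|lborel. norm (c n * z ^ n) * norm (h t))"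
        by (intro integral_mono integrable_norm f_int integrable_mult_right h norm_f)
      thus "norm (LINT t|lborel. norm (f n t)) \<le> norm (c n * z ^ n) * (LINT t|lborel. norm (h t))"
        using h by simp
    qed
  qed
  moreover have "(\<Sum>n. f n t) = h t * \<phi> (of_real t * z)" for t
  proof (cases "t \<in> {0<..<1}")
    case True
    have "f n t = h t * (c n * (of_real t * z) ^ n)" for n
      by (simp add: f_def power_mult_distrib mult_ac)
    thus ?thesis using sums_mult[OF sums[OF True], of "h t"] by (simp add: sums_iff)
  qed (simp add: f_def supp)
  ultimately show ?thesis
    using ht by (simp add: f_def)
qed

section \<open>The binomial series and integrals on the cut plane\<close>

lemma sums_one_minus_powr:
  fixes a z :: complex
  assumes "norm z < 1"
  shows "(\<lambda>n. pochhammer a n / fact n * z ^ n) sums (1 - z) powr (-a)"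
proof -
  have "(-a gchoose n) * (-z) ^ n = pochhammer a n / fact n * z ^ n" for n
  proof -
    \<comment> \<open>The sign (-1)^n in the binomial coefficient of -a cancels the one in
      (-z)^n.\<close>
    have "(-a gchoose n) * (-z) ^ n = ((-1) * (-z)) ^ n * pochhammer a n / fact n"
      unfolding power_mult_distrib by (simp add: gbinomial_pochhammer)
    thus ?thesis by simp
  qed
  with gen_binomial_complex[of "-z" "-a"] assms show ?thesis by simp
qed

text \<open>Convergence at a radius \<open>r\<close> strictly between \<open>norm z\<close> and 1
  makes the power series absolutely convergent at \<open>z\<close>.\<close>

lemma summable_norm_one_minus_powr:
  fixes a z :: complex
  assumes "norm z < 1"
  shows "summable (\<lambda>n. norm (pochhammer a n / fact n * z ^ n))"
proof -
  from assms obtain r where r: "norm z < r" "r < 1" using dense by blast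
  have "0 < r" using r(1) norm_ge_zero[of z] by linarith
  hence "norm (complex_of_real r) = r" by simp
  with r sums_summable[OF sums_one_minus_powr[of "of_real r" a]] show ?thesis
    by (intro powser_insidea[of _ "of_real r"]) auto
qed

text \<open>The branch cut of the principal power, \<open>1 - z\<close> real and nonpositive, is
  exactly the ray removed from the plane.\<close>

lemma holomorphic_on_cut_plane_powr: "(\<lambda>z. (1 - z) powr (-a)) holomorphic_on cut_plane"
proof -
  have "1 - z \<notin> \<real>\<^sub>\<le>\<^sub>0" if "z \<in> cut_plane" for z
  proof
    assume "1 - z \<in> \<real>\<^sub>\<le>\<^sub>0"
    then obtain x where "1 - z = of_real x" "x \<le> 0" by (auto elim!: nonpos_Reals_cases)
    hence "z = of_real (1 - x)" "1 - x \<in> {1..}" by (auto simp: algebra_simps)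
    with that show False unfolding cut_plane_def by blast
  qed
  thus ?thesis by (intro holomorphic_intros) auto
qed

lemma cut_plane_dilation:
  assumes "z \<in> cut_plane" "0 \<le> t" "t \<le> 1"
  shows "of_real t * z \<in> cut_plane"
proof (rule ccontr)
  assume "of_real t * z \<notin> cut_plane"
  then obtain x where x: "x \<ge> 1" "of_real t * z = of_real x" by (auto simp: cut_plane_def)
  hence "t > 0" using assms by (cases "t = 0") auto
  hence "z = of_real (x / t)" "x / t \<ge> 1" using x assms by (auto simp: field_simps)
  thus False using assms(1) unfolding cut_plane_def by blast
qed

text \<open>The Euler integral is holomorphic on the whole cut plane and expands in the disc into
  the series with moments \<open>m\<close>, so it is the continuation. Leaving \<open>h\<close> and
  \<open>m\<close> abstract serves \<open>Gauss_F\<close> and \<open>ext_Gauss_F\<close>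
  alike.\<close>

lemma cut_plane_continuation_integral:
  fixes h :: "real \<Rightarrow> complex" and m :: "nat \<Rightarrow> complex"
  assumes h: "integrable lborel h" and supp: "\<And>t. t \<notin> {0<..<1} \<Longrightarrow> h t = 0"
    and m: "\<And>n. m n = C * (LINT t|lborel. h t * of_real t ^ n)" and z: "z \<in> cut_plane"
  shows "cut_plane_continuation (\<lambda>z. \<Sum>n. pochhammer a n * m n * (z ^ n / fact n)) z =
           C * (LINT t|lborel. h t * (1 - of_real t * z) powr (-a))"
proof (rule cut_plane_continuation_eq[OF _ _ z])
  show "(\<lambda>z. C * (LINT t|lborel. h t * (1 - of_real t * z) powr (-a))) holomorphic_on cut_plane"
    by (intro holomorphic_on_mult holomorphic_on_const holomorphic_on_integral_dilation[OF h supp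
          open_cut_plane cut_plane_dilation holomorphic_on_cut_plane_powr])
  fix z :: complex assume "z \<in> ball 0 1"
  hence z: "norm z < 1" by simp
  have "(\<lambda>n. pochhammer a n / fact n * z ^ n * (LINT t|lborel. h t * of_real t ^ n)) sums
          (LINT t|lborel. h t * (1 - of_real t * z) powr (-a))"
  proof (rule sums_integral_power_series[OF h supp summable_norm_one_minus_powr[OF z]])
    fix t :: real assume "t \<in> {0<..<1}"
    hence "norm (of_real t * z) < 1"
      using z mult_le_one[of t "norm z"] mult_strict_mono[of t 1 "norm z" 1] by (auto simp: norm_mult)
    thus "(\<lambda>n. pochhammer a n / fact n * (of_real t * z) ^ n) sums (1 - of_real t * z) powr (-a)"
      by (rule sums_one_minus_powr)
  qed
  from sums_mult[OF this, of C]
  show "C * (LINT t|lborel. h t * (1 - of_real t * z) powr (-a)) =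
          (\<Sum>n. pochhammer a n * m n * (z ^ n / fact n))"
    by (simp add: sums_iff m mult_ac)
qed

text \<open>The confluent counterpart: the exponential series converges everywhere, so no
  continuation enters.\<close>

lemma suminf_exp_integral:
  fixes h :: "real \<Rightarrow> complex" and m :: "nat \<Rightarrow> complex"
  assumes h: "integrable lborel h" and supp: "\<And>t. t \<notin> {0<..<1} \<Longrightarrow> h t = 0"
    and m: "\<And>n. m n = C * (LINT t|lborel. h t * of_real t ^ n)"
  shows "(\<Sum>n. m n * (z ^ n / fact n)) = C * (LINT t|lborel. h t * exp (of_real t * z))"
proof -
  have exp: "(\<lambda>n. 1 / fact n * w ^ n) sums exp w" for w :: complex
    using exp_converges[of w] by (simp add: scaleR_conv_of_real field_simps)
  have "summable (\<lambda>n. norm (1 / fact n * z ^ n))"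
    using summable_norm_exp[of z] by (simp add: norm_mult norm_inverse divide_inverse mult.commute)
  from sums_mult[OF sums_integral_power_series[OF h supp this exp], of C]
  show ?thesis by (simp add: sums_iff m mult_ac)
qed

subsection \<open>Euler integrals\<close>

text \<open>The power t^n shifts \<open>b\<close> to \<open>b + n\<close>. The resulting Gamma
  quotients are the Pochhammer ratios in the hypergeometric coefficients, which makes both classical
  functions Euler integrals of one weight.\<close>

lemma Beta_moment:
  assumes "Re b > 0" "Re d > 0"
  shows "(LINT t|lborel. pos_powr t (b - 1) * pos_powr (1 - t) (d - 1) * of_real t ^ n) =
           Beta b d * (pochhammer b n / pochhammer (b + d) n)"
proof -
  have "pos_powr t (b - 1) * pos_powr (1 - t) (d - 1) * of_real t ^ n =
        pos_powr t (b + of_nat n - 1) * pos_powr (1 - t) (d - 1)" for t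
  proof (cases "t > 0")
    case True
    hence "pos_powr t (b + of_nat n - 1) = pos_powr t (b - 1) * of_real t ^ n"
      using pos_powr_add[of t "b - 1" "of_nat n"] by (simp add: pos_powr_of_nat algebra_simps)
    thus ?thesis by (simp add: mult_ac)
  qed (simp add: pos_powr_nonpos)
  hence "(LINT t|lborel. pos_powr t (b - 1) * pos_powr (1 - t) (d - 1) * of_real t ^ n) =
        Beta (b + of_nat n) d"
    using has_bochner_integral_Beta[of "b + of_nat n" d] assms
    by (simp only: has_bochner_integral_iff) simp
  also have "\<dots> = Beta b d * (pochhammer b n / pochhammer (b + d) n)"
  proof -
    have np: "b \<notin> \<int>\<^sub>\<le>\<^sub>0" "b + d \<notin> \<int>\<^sub>\<le>\<^sub>0"
      using assms by (auto intro!: Re_pos_imp_not_nonpos_Int)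
    hence "Gamma b \<noteq> 0" "Gamma (b + d) \<noteq> 0" by (auto simp: Gamma_eq_zero_iff)
    thus ?thesis using np by (simp add: Beta_def pochhammer_Gamma add_ac)
  qed
  finally show ?thesis .
qed

lemma Beta_nonzero:
  fixes b d :: complex
  assumes "Re b > 0" "Re d > 0"
  shows "Beta b d \<noteq> 0"
  using assms Re_pos_imp_not_nonpos_Int[of "b + d"]
  by (auto simp: Beta_def Gamma_eq_zero_iff dest: Re_pos_imp_not_nonpos_Int)

lemma Gauss_F_Euler_integral:
  assumes "Re b > 0" "Re d > 0" "z \<in> cut_plane"
  shows "(LINT t|lborel. pos_powr t (b - 1) * pos_powr (1 - t) (d - 1) * (1 - of_real t * z) powr (-a)) =
           Beta b d * Gauss_F a b (b + d) z"
proof -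
  have "eval_fps (fps_hypergeo [a, b] [b + d] 1) =
      (\<lambda>z. \<Sum>n. pochhammer a n * (pochhammer b n / pochhammer (b + d) n) * (z ^ n / fact n))"
    by (simp add: eval_fps_def fun_eq_iff)
  moreover have "cut_plane_continuation
      (\<lambda>z. \<Sum>n. pochhammer a n * (pochhammer b n / pochhammer (b + d) n) * (z ^ n / fact n)) z =
      1 / Beta b d * (LINT t|lborel. pos_powr t (b - 1) * pos_powr (1 - t) (d - 1) * (1 - of_real t * z) powr (-a))"
    using has_bochner_integral_Beta[OF assms(1,2)] Beta_nonzero[OF assms(1,2)] assms(3)
    by (intro cut_plane_continuation_integral)
       (auto simp: has_bochner_integral_iff pos_powr_nonpos Beta_moment[OF assms(1,2)])
  ultimately show ?thesis
    using Beta_nonzero[OF assms(1,2)] by (simp add: Gauss_F_def)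
qed

lemma Kummer_Phi_Euler_integral:
  assumes "Re b > 0" "Re d > 0"
  shows "(LINT t|lborel. pos_powr t (b - 1) * pos_powr (1 - t) (d - 1) * exp (of_real t * z)) =
           Beta b d * Kummer_Phi b (b + d) z"
proof -
  have "Kummer_Phi b (b + d) z = (\<Sum>n. pochhammer b n / pochhammer (b + d) n * (z ^ n / fact n))"
    by (simp add: Kummer_Phi_def eval_fps_def)
  also have "\<dots> = 1 / Beta b d * (LINT t|lborel. pos_powr t (b - 1) * pos_powr (1 - t) (d - 1) * exp (of_real t * z))"
    using has_bochner_integral_Beta[OF assms] Beta_nonzero[OF assms]
    by (intro suminf_exp_integral)
       (auto simp: has_bochner_integral_iff pos_powr_nonpos Beta_moment[OF assms])
  finally show ?thesis using Beta_nonzero[OF assms] by simp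
qed

subsection \<open>The extended functions\<close>

text \<open>The Bessel argument is written as a scale times \<open>p\<close>, as
  \<open>Mellin_integral_mixture\<close> requires. The prefactor sqrt(2p/pi) is left out and joins
  the power of \<open>p\<close> later.\<close>

definition ext_Beta_kernel :: "complex \<Rightarrow> complex \<Rightarrow> complex \<Rightarrow> real \<Rightarrow> real \<Rightarrow> complex" where
  "ext_Beta_kernel \<nu> x y p t = pos_powr t (x - 3/2) * pos_powr (1 - t) (y - 3/2) *
     bessel_K_Lebesgue (\<nu> + 1/2) (1 / (t * (1 - t)) * p)"

lemma ext_Beta_kernel_eq_0: "t \<notin> {0<..<1} \<Longrightarrow> ext_Beta_kernel \<nu> x y p t = 0"
  by (auto simp: ext_Beta_kernel_def pos_powr_nonpos)

text \<open>All coefficients of the extended series are moments of one kernel, because t^n only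
  raises the exponent of t. As t^n is bounded, integrability for n = 0 passes to every n.\<close>

lemma ext_Beta_eq_integral:
  assumes "p > 0" and int: "integrable lborel (ext_Beta_kernel \<nu> x y p)"
  shows "ext_Beta p \<nu> (x + of_nat n) y =
           of_real (sqrt (2 * p / pi)) * (LINT t|lborel. ext_Beta_kernel \<nu> x y p t * of_real t ^ n)"
proof -
  let ?f = "\<lambda>t. of_real t powr (x + of_nat n - 3/2) * of_real (1 - t) powr (y - 3/2) *
       bessel_K (\<nu> + 1/2) (of_real (p / (t * (1 - t))))"
  have eq: "indicator {0<..<1} t *\<^sub>R ?f t = ext_Beta_kernel \<nu> x y p t * of_real t ^ n" for t
  proof (cases "t \<in> {0<..<1}")
    case True
    have "pos_powr t (x + of_nat n - 3/2) = pos_powr t (x - 3/2) * of_real t ^ n"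
      using True pos_powr_add[of t "x - 3/2" "of_nat n"] by (simp add: pos_powr_of_nat algebra_simps)
    moreover have "bessel_K (\<nu> + 1/2) (of_real (p / (t * (1 - t)))) =
        bessel_K_Lebesgue (\<nu> + 1/2) (p / (t * (1 - t)))"
      using True assms by (intro bessel_K_eq_Lebesgue) auto
    ultimately show ?thesis
      using True by (simp add: ext_Beta_kernel_def pos_powr_pos mult_ac)
  qed (simp add: ext_Beta_kernel_eq_0)
  have "integrable lborel (\<lambda>t. ext_Beta_kernel \<nu> x y p t * of_real t ^ n)"
    by (intro integrable_mult_continuous_on[OF int ext_Beta_kernel_eq_0] continuous_intros)
  hence "set_integrable lborel {0<..<1} ?f"
    by (simp only: set_integrable_def eq)
  from set_borel_integral_eq_integral(2)[OF this] show ?thesis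
    by (simp only: ext_Beta_def set_lebesgue_integral_def eq)
qed

lemma ext_Gauss_F_Euler_integral:
  assumes "p > 0" "integrable lborel (ext_Beta_kernel \<nu> b (c - b) p)" "z \<in> cut_plane"
  shows "ext_Gauss_F p \<nu> a b c z = of_real (sqrt (2 * p / pi)) / Beta b (c - b) *
           (LINT t|lborel. ext_Beta_kernel \<nu> b (c - b) p t * (1 - of_real t * z) powr (-a))"
  unfolding ext_Gauss_F_def using assms
  by (intro cut_plane_continuation_integral) (auto simp: ext_Beta_kernel_eq_0 ext_Beta_eq_integral)

lemma ext_Kummer_Phi_Euler_integral:
  assumes "p > 0" "integrable lborel (ext_Beta_kernel \<nu> b (c - b) p)"
  shows "ext_Kummer_Phi p \<nu> b c z = of_real (sqrt (2 * p / pi)) / Beta b (c - b) *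
           (LINT t|lborel. ext_Beta_kernel \<nu> b (c - b) p t * exp (of_real t * z))"
  unfolding ext_Kummer_Phi_def using assms
  by (intro suminf_exp_integral) (auto simp: ext_Beta_kernel_eq_0 ext_Beta_eq_integral)

text \<open>This is \<open>Mellin_integral_mixture\<close> for the Bessel function with
  \<open>w = s + 1/2\<close> and scale 1/(t(1-t)). The factor (t(1-t))^w turns the exponents x-3/2
  and y-3/2 into x+s-1 and y+s-1, and the first two hypotheses say precisely that |Re \<mu>| < Re
  w.\<close>

lemma Mellin_ext_Beta_kernel:
  fixes \<psi> :: "real \<Rightarrow> complex"
  assumes "Re (s - \<nu>) > 0" "Re (s + \<nu>) > -1" "Re (x + s) > 0" "Re (y + s) > 0"
    and cont: "continuous_on {0..1} \<psi>"
  shows "AE p in lborel. p > 0 \<longrightarrow> integrable lborel (ext_Beta_kernel \<nu> x y p)"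
    and "has_bochner_integral lborel
           (\<lambda>p. pos_powr p (s - 1/2) * (LINT t|lborel. ext_Beta_kernel \<nu> x y p t * \<psi> t))
           (2 powr (s - 3/2) * Gamma ((s - \<nu>) / 2) * Gamma ((s + \<nu> + 1) / 2) *
             (LINT t|lborel. pos_powr t (x + s - 1) * pos_powr (1 - t) (y + s - 1) * \<psi> t))"
proof -
  define w \<mu> where "w = s + 1/2" and "\<mu> = \<nu> + 1/2"
  define g where "g t = pos_powr t (x - 3/2) * pos_powr (1 - t) (y - 3/2)" for t
  define q :: "real \<Rightarrow> real" where "q t = 1 / (t * (1 - t))" for t
  define e where "e t = pos_powr t (x + s - 1) * pos_powr (1 - t) (y + s - 1)" for t
  \<comment> \<open>Continuity is known only on [0,1]; the cut-off is Borel measurable on the line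
    and agrees with \<open>\<psi>\<close> wherever \<open>g\<close> is nonzero.\<close>
  define \<psi>' where "\<psi>' t = indicator {0..1} t *\<^sub>R \<psi> t" for t :: real
  have [measurable]: "g \<in> borel_measurable borel" "q \<in> borel_measurable borel"
    unfolding g_def q_def by measurable
  have [measurable]: "\<psi>' \<in> borel_measurable borel"
    unfolding \<psi>'_def by (rule borel_measurable_continuous_on_indicator[OF _ cont]) auto
  have K: "has_bochner_integral lborel (\<lambda>p. pos_powr p (w - 1) * bessel_K_Lebesgue \<mu> p)
      (2 powr (w - 2) * Gamma ((w - \<mu>) / 2) * Gamma ((w + \<mu>) / 2))"
    using assms by (intro has_bochner_integral_Mellin_bessel_K) (auto simp: w_def \<mu>_def)
  have q: "q t > 0" if "g t \<noteq> 0" for t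
    using that by (auto simp: g_def q_def not_le)
  have gq: "g t * pos_powr (q t) (-w) = e t" for t
  proof (cases "t \<in> {0<..<1}")
    case True
    have "q t = inverse (t * (1 - t))" by (simp add: q_def inverse_eq_divide)
    hence "pos_powr (q t) (-w) = pos_powr t w * pos_powr (1 - t) w"
      using True by (simp only: pos_powr_inverse) (simp add: pos_powr_mult)
    moreover have "pos_powr r (v - 3/2) * pos_powr r w = pos_powr r (v + s - 1)" for r v
      by (simp add: w_def flip: pos_powr_add)
    ultimately show ?thesis
      by (simp add: g_def e_def) (metis (no_types, lifting) mult.assoc mult.left_commute)
  qed (auto simp: g_def e_def pos_powr_nonpos)
  have e: "integrable lborel e"
    using has_bochner_integral_Beta[of "x + s" "y + s"] assms
    by (simp add: has_bochner_integral_iff e_def[abs_def])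
  have e0: "e t = 0" if "t \<notin> {0<..<1}" for t
    using that by (auto simp: e_def pos_powr_nonpos)
  have kernel: "ext_Beta_kernel \<nu> x y p t = g t * bessel_K_Lebesgue \<mu> (q t * p)" for p t
    by (simp add: ext_Beta_kernel_def g_def q_def \<mu>_def)
  \<comment> \<open>First without \<open>\<psi>\<close>: the almost-everywhere claim concerns the
    kernel itself, from which the extended coefficients are formed.\<close>
  have "has_bochner_integral lborel (\<lambda>t. g t * pos_powr (q t) (-w)) (LINT t|lborel. e t)"
    using e by (simp add: gq has_bochner_integral_iff)
  from Mellin_integral_mixture(1)[OF _ _ _ K this q]
  show "AE p in lborel. p > 0 \<longrightarrow> integrable lborel (ext_Beta_kernel \<nu> x y p)"
    by (simp add: kernel[abs_def])
  have \<psi>': "g t * \<psi>' t = g t * \<psi> t" "e t * \<psi>' t = e t * \<psi> t" for t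
    using e0[of t] by (auto simp: \<psi>'_def indicator_def g_def pos_powr_nonpos)
  have "has_bochner_integral lborel (\<lambda>t. g t * \<psi>' t * pos_powr (q t) (-w)) (LINT t|lborel. e t * \<psi> t)"
  proof -
    have "g t * \<psi>' t * pos_powr (q t) (-w) = e t * \<psi> t" for t
      using gq[of t] \<psi>'(2)[of t] by (simp add: mult_ac)
    thus ?thesis
      using integrable_mult_continuous_on[OF e e0 cont] by (simp add: has_bochner_integral_iff)
  qed
  from Mellin_integral_mixture(2)[OF _ _ _ K this]
  have "has_bochner_integral lborel
      (\<lambda>p. pos_powr p (w - 1) * (LINT t|lborel. g t * \<psi>' t * bessel_K_Lebesgue \<mu> (q t * p)))
      (2 powr (w - 2) * Gamma ((w - \<mu>) / 2) * Gamma ((w + \<mu>) / 2) * (LINT t|lborel. e t * \<psi> t))"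
    using q by simp
  moreover have "g t * \<psi>' t * bessel_K_Lebesgue \<mu> (q t * p) = ext_Beta_kernel \<nu> x y p t * \<psi> t" for t p
    unfolding kernel \<psi>'(1) by (simp add: mult_ac)
  moreover have "w - 1 = s - 1/2" "w - 2 = s - 3/2" "w - \<mu> = s - \<nu>" "w + \<mu> = s + \<nu> + 1"
    by (simp_all add: w_def \<mu>_def)
  ultimately show "has_bochner_integral lborel
           (\<lambda>p. pos_powr p (s - 1/2) * (LINT t|lborel. ext_Beta_kernel \<nu> x y p t * \<psi> t))
           (2 powr (s - 3/2) * Gamma ((s - \<nu>) / 2) * Gamma ((s + \<nu> + 1) / 2) *
             (LINT t|lborel. pos_powr t (x + s - 1) * pos_powr (1 - t) (y + s - 1) * \<psi> t))"
    by (simp only: e_def)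
qed

text \<open>
  Fubini gives integrability of the kernel only for almost every \<open>p\<close>, which is all that the
  integral over \<open>p\<close> sees.
\<close>
lemma Mellin_transform_Euler_integral:
  fixes F :: "real \<Rightarrow> complex" and \<psi> :: "real \<Rightarrow> complex"
  assumes par: "Re (s - \<nu>) > 0" "Re (s + \<nu>) > -1" "Re (x + s) > 0" "Re (y + s) > 0"
    and cont: "continuous_on {0..1} \<psi>"
    and F: "\<And>p. p > 0 \<Longrightarrow> integrable lborel (ext_Beta_kernel \<nu> x y p) \<Longrightarrow>
              F p = of_real (sqrt (2 * p / pi)) / B *
                      (LINT t|lborel. ext_Beta_kernel \<nu> x y p t * \<psi> t)"
  shows "integral {0<..} (\<lambda>p. of_real p powr (s - 1) * F p) =
           2 powr (s - 1) / of_real (sqrt pi) * Gamma ((s - \<nu>) / 2) * Gamma ((s + \<nu> + 1) / 2) *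
           ((LINT t|lborel. pos_powr t (x + s - 1) * pos_powr (1 - t) (y + s - 1) * \<psi> t) / B)"
    (is "_ = ?R")
proof -
  \<comment> \<open>The prefactor sqrt(2p/pi) is split: its constant part goes into
    \<open>C\<close>, and sqrt(p) raises the exponent of \<open>p\<close> from s-1 to s-1/2.\<close>
  define C :: complex where "C = of_real (sqrt (2 / pi)) / B"
  define G where "G p = C * (pos_powr p (s - 1/2) * (LINT t|lborel. ext_Beta_kernel \<nu> x y p t * \<psi> t))" for p
  note Mellin = Mellin_ext_Beta_kernel[OF par cont]
  have "C * 2 powr (s - 3/2) = 2 powr (s - 1) / of_real (sqrt pi) / B"
  proof -
    have "2 powr (s - 1) = 2 powr (1/2) * 2 powr (s - 3/2)"
      by (simp flip: powr_add)
    also have "2 powr (1/2) = complex_of_real (sqrt 2)"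
      by (simp add: of_real_sqrt csqrt_conv_powr)
    finally show ?thesis by (simp add: C_def real_sqrt_divide)
  qed
  hence "has_bochner_integral lborel G ?R"
    using has_bochner_integral_mult_right[OF Mellin(2), of C]
    by (simp add: G_def[abs_def] flip: mult.assoc)
  moreover have "indicator {0<..} p *\<^sub>R G p = G p" for p
    by (auto simp: G_def indicator_def pos_powr_nonpos)
  ultimately have "set_integrable lborel {0<..} G" "(LINT p:{0<..}|lborel. G p) = ?R"
    by (simp_all add: set_integrable_def set_lebesgue_integral_def has_bochner_integral_iff)
  hence G: "(G has_integral ?R) {0<..}"
    using set_borel_integral_eq_integral[of "{0<..}" G] by (simp add: has_integral_integrable_integral)
  obtain N where N: "N \<in> null_sets lborel"
      "\<And>p. p \<in> space lborel - N \<Longrightarrow> p > 0 \<longrightarrow> integrable lborel (ext_Beta_kernel \<nu> x y p)"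
    by (rule AE_E3[OF Mellin(1)]) blast
  have "negligible N"
    using N(1) by (simp add: negligible_iff_null_sets null_sets_completionI)
  moreover have "of_real p powr (s - 1) * F p = G p" if "p \<in> {0<..} - N" for p
  proof -
    have p: "p > 0" using that by simp
    have "of_real (sqrt p) = pos_powr p (1/2)"
      using p by (simp add: pos_powr_def of_real_sqrt csqrt_conv_powr)
    hence "pos_powr p (s - 1/2) = pos_powr p (s - 1) * of_real (sqrt p)"
      by (simp flip: pos_powr_add)
    thus ?thesis
      using F[OF p] N(2)[of p] that
      by (simp add: G_def C_def pos_powr_pos real_sqrt_divide real_sqrt_mult)
  qed
  ultimately have "((\<lambda>p. of_real p powr (s - 1) * F p) has_integral ?R) {0<..}"
    using G by (rule has_integral_spike)
  thus ?thesis by (rule integral_unique)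
qed

section \<open>The two Mellin transforms\<close>

theorem theorem14:
  fixes a b c \<nu> s :: complex
  assumes "Re c > Re b" and "Re b > 0"
    and "Re (s - \<nu>) > 0" and "Re (s + \<nu>) > -1"
    and "Re (b + s) > 0" and "Re (c - b + s) > 0"
  shows "(\<forall>z\<in>cut_plane.
            (\<lambda>p. of_real p powr (s - 1) * ext_Gauss_F p \<nu> a b c z) integrable_on {0<..} \<longrightarrow>
            integral {0<..} (\<lambda>p. of_real p powr (s - 1) * ext_Gauss_F p \<nu> a b c z) =
              2 powr (s - 1) / of_real (sqrt pi) *
              Gamma ((s - \<nu>) / 2) * Gamma ((s + \<nu> + 1) / 2) *
              (Beta (b + s) (c + s - b) / Beta b (c - b)) * Gauss_F a (b + s) (c + 2 * s) z)
       \<and> (\<forall>z.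
            (\<lambda>p. of_real p powr (s - 1) * ext_Kummer_Phi p \<nu> b c z) integrable_on {0<..} \<longrightarrow>
            integral {0<..} (\<lambda>p. of_real p powr (s - 1) * ext_Kummer_Phi p \<nu> b c z) =
              2 powr (s - 1) / of_real (sqrt pi) *
              Gamma ((s - \<nu>) / 2) * Gamma ((s + \<nu> + 1) / 2) *
              (Beta (b + s) (c + s - b) / Beta b (c - b)) * Kummer_Phi (b + s) (c + 2 * s) z)"
proof -
  \<comment> \<open>The Euler integrals have parameters \<open>b + s\<close> and
    \<open>c - b + s\<close>; their sum is the lower parameter \<open>c + 2 * s\<close> of the
    classical functions.\<close>
  have eqs: "c - b + s = c + s - b" "b + s + (c + s - b) = c + 2 * s"
    by (simp_all add: algebra_simps)
  note Mellin = Mellin_transform_Euler_integral[OF assms(3-6)]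
  show ?thesis
  proof (intro conjI ballI allI impI)
    fix z assume z: "z \<in> cut_plane"
    have "continuous_on cut_plane (\<lambda>w. (1 - w) powr (-a))"
      by (intro holomorphic_on_imp_continuous_on holomorphic_on_cut_plane_powr)
    \<comment> \<open>The segment from 0 to \<open>z\<close> stays in the cut plane.\<close>
    hence "continuous_on {0..1} (\<lambda>t. (1 - of_real t * z) powr (-a))"
      by (rule continuous_on_compose2[where f = "\<lambda>t. of_real t * z"])
         (auto intro!: continuous_intros cut_plane_dilation z)
    from Mellin[OF this ext_Gauss_F_Euler_integral[OF _ _ z]]
    show "integral {0<..} (\<lambda>p. of_real p powr (s - 1) * ext_Gauss_F p \<nu> a b c z) =
              2 powr (s - 1) / of_real (sqrt pi) *
              Gamma ((s - \<nu>) / 2) * Gamma ((s + \<nu> + 1) / 2) *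
              (Beta (b + s) (c + s - b) / Beta b (c - b)) * Gauss_F a (b + s) (c + 2 * s) z"
      using Gauss_F_Euler_integral[OF assms(5,6) z, of a] by (simp add: eqs)
  next
    fix z :: complex
    have "continuous_on {0..1} (\<lambda>t. exp (of_real t * z))"
      by (intro continuous_intros)
    from Mellin[OF this ext_Kummer_Phi_Euler_integral]
    show "integral {0<..} (\<lambda>p. of_real p powr (s - 1) * ext_Kummer_Phi p \<nu> b c z) =
              2 powr (s - 1) / of_real (sqrt pi) *
              Gamma ((s - \<nu>) / 2) * Gamma ((s + \<nu> + 1) / 2) *
              (Beta (b + s) (c + s - b) / Beta b (c - b)) * Kummer_Phi (b + s) (c + 2 * s) z"
      using Kummer_Phi_Euler_integral[OF assms(5,6), of z] by (simp add: eqs)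
  qed
qed

end
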